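(* Let $K \ge 1$ be an integer. For every policy $\pi$ for $K$ arms, there exists a tuple $\mu_1^K = (\mu_1,\ldots,\mu_K)$ of probability distributions on $[0,1]$ such that $$\limsup_{T \to \infty} R_T^{\pi,\pi_*} \ge K,$$ where $\pi_*$ is the single-armed oracle and $R_T^{\pi,\pi_*}$ is the extreme regret of $\pi$ with respect to $\pi_*$ over time horizon $T$ on the tuple $\mu_1^K$.
   Context: Setting (extreme bandit, cost minimization). Given a tuple $\mu_1^K=(\mu_1,\ldots,\mu_K)$ of probability distributions (arms) on $[0,1]$, let $x_{k,t}$ ($1\le k\le K$, integer $t \ge 1$) be independent random variables with $x_{k,t}\sim\mu_k$. Policy: a policy $\pi$ is a deterministic rule (measurable in the observed values, and not depending on $\mu_1^K$) that at each time $t\ge 1$ chooses an arm index $k_t\in\{1,\ldots,K\}$ as a function of the past arm choices and past observed values: $k_t=\pi(k_1,\ldots,k_{t-1},x_{k_1,1},\ldots,x_{k_{t-1},t-1})$. It does not know the time horizon. After choosing $k_t$ it observes $x_{k_t,t}$. Single-armed oracle: for a time horizon $T$, the single-armed oracle $\pi_*$ knows $\mu_1^K$ and plays at all times $t\le T$ a single arm $k_* \in \operatorname{argmin}_k \mathbb E[\min_{t\le T} x_{k,t}]$ (which may depend on $T$). Thus its expected best cost over horizon $T$ is $\mathbb E[\min_{t\le T}x_{k_*,t}] = \min_{k} \mathbb E[\min_{t\le T} x_{k,t}]$. Extreme regret: for an integer $T \ge 1$, $$R_T^{\pi,\pi_*}=\frac1T\min_{T'\ge1}\left\{T' : \mathbb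 E\left[\min_{t\le T'}x_{k_t,t}\right]\le \mathbb E\left[\min_{t\le T}x_{k_*,t}\right]\right\},$$ where $T'$ ranges over positive integers, $k_t$ are the choices of $\pi$ on $\mu_1^K$, and the minimum of the empty set is $+\infty$. *)

theory Defs
  imports "HOL-Probability.Probability"
begin

text \<open>
  Arms are numbered \<open>1, \<dots>, K\<close> and time starts at \<open>1\<close>. An outcome \<open>x\<close> of the sample space
  assigns to every arm \<open>k\<close> and time \<open>t\<close> the value \<open>x (k, t)\<close>.
\<close>

abbreviation unit_borel :: "real measure" where
  "unit_borel \<equiv> restrict_space borel {0..1}"

definition arm_distribution :: "real measure \<Rightarrow> bool" where
  "arm_distribution M \<longleftrightarrow> prob_space M \<and> sets M = sets unit_borel"

definition sample_space :: "nat \<Rightarrow> (nat \<Rightarrow> real measure) \<Rightarrow> (nat \<times> nat \<Rightarrow> real) measure" where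
  "sample_space K \<mu> = Pi\<^sub>M ({1..K} \<times> {1..}) (\<lambda>(k, t). \<mu> k)"

text \<open>
  \<open>\<pi> ks xs\<close> is the arm chosen after the arms \<open>ks\<close> have been played and the values \<open>xs\<close>
  (of the same length) have been observed. There is no sigma-algebra on lists in use here, so
  measurability in the observed values is required separately for each list of past arms,
  with the observed values ranging over \<open>[0,1]\<^sup>n\<close> for \<open>n = length ks\<close>. Membership in the space of
  measurable functions also forces the chosen arm to lie in \<open>{1..K}\<close>.
\<close>

definition policy :: "nat \<Rightarrow> (nat list \<Rightarrow> real list \<Rightarrow> nat) \<Rightarrow> bool" where
  "policy K \<pi> \<longleftrightarrow>
     (\<forall>ks. set ks \<subseteq> {1..K} \<longrightarrow>
        (\<lambda>v. \<pi> ks (map v [0..<length ks]))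
          \<in> measurable (Pi\<^sub>M {..<length ks} (\<lambda>_. unit_borel)) (count_space {1..K}))"

function chosen_arm ::
  "(nat list \<Rightarrow> real list \<Rightarrow> nat) \<Rightarrow> (nat \<times> nat \<Rightarrow> real) \<Rightarrow> nat \<Rightarrow> nat" where
  "chosen_arm \<pi> x t =
     \<pi> (map (\<lambda>s. chosen_arm \<pi> x s) [1..<t]) (map (\<lambda>s. x (chosen_arm \<pi> x s, s)) [1..<t])"
  by auto
termination
  by (relation "Wellfounded.measure (\<lambda>(\<pi>, x, t). t)") auto

declare chosen_arm.simps [simp del]

text \<open>
  \<open>\<kappa> x t\<close> is the arm played at time \<open>t\<close> on the outcome \<open>x\<close>.
\<close>

definition expected_best_cost ::
  "nat \<Rightarrow> (nat \<Rightarrow> real measure) \<Rightarrow> ((nat \<times> nat \<Rightarrow> real) \<Rightarrow> nat \<Rightarrow> nat) \<Rightarrow> nat \<Rightarrow> real" where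
  "expected_best_cost K \<mu> \<kappa> T =
     (\<integral>x. (MIN t\<in>{1..T}. x (\<kappa> x t, t)) \<partial>sample_space K \<mu>)"

definition oracle_arm :: "nat \<Rightarrow> (nat \<Rightarrow> real measure) \<Rightarrow> nat \<Rightarrow> nat" where
  "oracle_arm K \<mu> T = arg_min_on (\<lambda>k. expected_best_cost K \<mu> (\<lambda>_ _. k) T) {1..K}"

text \<open>
  The infimum is a minimum whenever the set of admissible \<open>T'\<close> is nonempty, and it is \<open>\<infinity>\<close>
  otherwise. The value for \<open>T = 0\<close> is meaningless.
\<close>

definition extreme_regret ::
  "nat \<Rightarrow> (nat \<Rightarrow> real measure) \<Rightarrow> (nat list \<Rightarrow> real list \<Rightarrow> nat) \<Rightarrow> nat \<Rightarrow> ereal" where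
  "extreme_regret K \<mu> \<pi> T =
     (INF T'\<in>{T'. 1 \<le> T' \<and>
          expected_best_cost K \<mu> (chosen_arm \<pi>) T'
            \<le> expected_best_cost K \<mu> (\<lambda>_ _. oracle_arm K \<mu> T) T}.
        ereal (real T')) / ereal (real T)"

end

theory Submission
  imports Defs
begin

text \<open>
  As long as the policy observes only the value \<open>1\<close>, its choices \<open>a 1, a 2, \<dots>\<close> are fixed in advance.
  By the pigeonhole principle some arm \<open>k\<^sub>0\<close> is chosen at most \<open>T / K\<close> times up to time \<open>T\<close>, for
  infinitely many \<open>T\<close>. Let \<open>k\<^sub>0\<close> be a fair coin on \<open>{0, 1}\<close> and let all other arms be constantly \<open>1\<close>.
  The best cost is \<open>1\<close> if and only if every play of \<open>k\<^sub>0\<close> along \<open>a\<close> yields \<open>1\<close>, so its expectation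
  is \<open>2\<close> to the power minus the number of plays of \<open>k\<^sub>0\<close>. Hence matching the oracle
  over horizon \<open>T\<close> takes at least \<open>T\<close> plays of \<open>k\<^sub>0\<close>, which infinitely often costs about \<open>K T\<close> rounds.
\<close>

section \<open>Dependence of the choices on the outcome\<close>

text \<open>Agreement is required only along the trajectory of \<open>y\<close>, because by
  induction \<open>x\<close> then produces the same trajectory. With \<open>y\<close> constantly 1,
  the policy follows a fixed sequence while it observes only 1.\<close>

lemma chosen_arm_cong:
  assumes "\<And>s. s \<in> {1..<t} \<Longrightarrow> x (chosen_arm \<pi> y s, s) = y (chosen_arm \<pi> y s, s)"
  shows "chosen_arm \<pi> x t = chosen_arm \<pi> y t"
  using assms
proof (induction t rule: less_induct)
  case (less t)
  have "chosen_arm \<pi> x s = chosen_arm \<pi> y s" if "s \<in> {1..<t}" for s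
    using that less.prems by (intro less.IH) auto
  then show ?case
    using less.prems
    by (subst (1 2) chosen_arm.simps) (auto intro!: arg_cong2[where f = \<pi>])
qed

text \<open>The past arms form one of finitely many lists, and for each fixed list the choice is a
  measurable function of the observed values. A general family \<open>X\<close> on \<open>N\<close>
  covers both the sample space and the constant outcome 1.\<close>

lemma measurable_chosen_arm:
  assumes "policy K \<pi>"
    and X: "\<And>k s. k \<in> {1..K} \<Longrightarrow> 1 \<le> s \<Longrightarrow> (\<lambda>\<omega>. X \<omega> (k, s)) \<in> measurable N unit_borel"
  shows "(\<lambda>\<omega>. chosen_arm \<pi> (X \<omega>) t) \<in> measurable N (count_space {1..K})"
proof (induction t rule: less_induct)
  case (less t)
  define L where "L = {ks. set ks \<subseteq> {1..K} \<and> length ks = t - 1}"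
  define past where "past \<omega> = map (\<lambda>s. chosen_arm \<pi> (X \<omega>) s) [1..<t]" for \<omega>
  \<comment> \<open>The restriction places the observed values in the product space over which
    \<open>policy\<close> demands measurability. List position \<open>i\<close> belongs to time
    \<open>Suc i\<close>.\<close>
  define choice where
    "choice ks \<omega> = \<pi> ks (map (\<lambda>i\<in>{..<length ks}. X \<omega> (ks ! i, Suc i)) [0..<length ks])" for ks \<omega>
  have "finite L"
    unfolding L_def by (rule finite_lists_length_eq) simp
  have nth_L: "ks ! i \<in> {1..K}" if "ks \<in> L" "i < length ks" for ks i
    using that nth_mem[OF that(2)] unfolding L_def by blast
  have played: "chosen_arm \<pi> (X \<omega>) s \<in> {1..K}" if "\<omega> \<in> space N" "s < t" for \<omega> s
    using measurable_space[OF less.IH[OF that(2)] that(1)] by simp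
  have past: "past \<in> measurable N (count_space L)"
    unfolding measurable_count_space_eq2[OF \<open>finite L\<close>]
  proof (intro conjI ballI)
    show "past \<in> space N \<rightarrow> L"
      using played by (fastforce simp: past_def L_def)
    fix ks assume ks: "ks \<in> L"
    have "past -` {ks} \<inter> space N =
        {\<omega> \<in> space N. \<forall>i\<in>{..<t-1}. chosen_arm \<pi> (X \<omega>) (Suc i) = ks ! i}"
      using ks by (auto simp: past_def L_def list_eq_iff_nth_eq)
    also have "\<dots> \<in> sets N"
    proof (intro sets.sets_Collect_finite_All)
      fix i assume i: "i \<in> {..<t-1}"
      then have "ks ! i \<in> {1..K}"
        using ks nth_L by (auto simp: L_def)
      moreover have "(\<lambda>\<omega>. chosen_arm \<pi> (X \<omega>) (Suc i)) \<in> measurable N (count_space {1..K})"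
        using i by (intro less.IH) auto
      ultimately have "(\<lambda>\<omega>. chosen_arm \<pi> (X \<omega>) (Suc i)) -` {ks ! i} \<inter> space N \<in> sets N"
        by (intro measurable_sets) auto
      then show "{\<omega> \<in> space N. chosen_arm \<pi> (X \<omega>) (Suc i) = ks ! i} \<in> sets N"
        by (simp add: vimage_def Collect_conj_eq Int_commute)
    qed simp
    finally show "past -` {ks} \<inter> space N \<in> sets N" .
  qed
  have choice: "choice ks \<in> measurable N (count_space {1..K})" if "ks \<in> L" for ks
  proof -
    have "(\<lambda>\<omega>. \<lambda>i\<in>{..<length ks}. X \<omega> (ks ! i, Suc i))
        \<in> measurable N (Pi\<^sub>M {..<length ks} (\<lambda>_. unit_borel))"
      using nth_L[OF that] by (intro measurable_restrict X) auto
    moreover have "(\<lambda>v. \<pi> ks (map v [0..<length ks]))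
        \<in> measurable (Pi\<^sub>M {..<length ks} (\<lambda>_. unit_borel)) (count_space {1..K})"
      using \<open>policy K \<pi>\<close> that unfolding policy_def L_def by blast
    ultimately show ?thesis
      unfolding choice_def by (rule measurable_compose)
  qed
  have "chosen_arm \<pi> (X \<omega>) t = choice (past \<omega>) \<omega>" for \<omega>
    unfolding choice_def past_def
    by (subst chosen_arm.simps) (auto intro!: arg_cong2[where f = \<pi>] simp: list_eq_iff_nth_eq)
  then show ?case
    using measurable_compose_countable'[OF choice past countable_finite[OF \<open>finite L\<close>]] by simp
qed

section \<open>Two-valued arms\<close>

text \<open>The parameter is the probability of the worst cost 1, so \<open>p = 1\<close> gives the
  constant arm and one family serves the whole instance.\<close>

definition binary_arm :: "real \<Rightarrow> real measure" where
  "binary_arm p = distr (measure_pmf (bernoulli_pmf p)) unit_borel of_bool"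

lemma sets_binary_arm [simp]: "sets (binary_arm p) = sets unit_borel"
  by (simp add: binary_arm_def)

lemma measurable_of_bool_unit_borel:
  "(of_bool :: bool \<Rightarrow> real) \<in> measurable (measure_pmf P) unit_borel"
  by (auto intro!: measurable_restrict_space2)

lemma prob_space_binary_arm: "prob_space (binary_arm p)"
  unfolding binary_arm_def
  by (intro prob_space.prob_space_distr prob_space_measure_pmf measurable_of_bool_unit_borel)

lemma arm_distribution_binary_arm: "arm_distribution (binary_arm p)"
  by (simp add: arm_distribution_def prob_space_binary_arm)

lemma singleton_1_in_sets_unit_borel: "{1} \<in> sets unit_borel"
  by (auto simp: sets_restrict_space_iff)

lemma emeasure_binary_arm_1:
  assumes "0 \<le> p" "p \<le> 1"
  shows "emeasure (binary_arm p) {1} = ennreal p"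
proof -
  have "emeasure (binary_arm p) {1} = emeasure (measure_pmf (bernoulli_pmf p)) {True}"
    unfolding binary_arm_def
    by (subst emeasure_distr[OF measurable_of_bool_unit_borel singleton_1_in_sets_unit_borel])
      (auto intro!: arg_cong[where f = "emeasure _"])
  then show ?thesis
    using assms by (simp add: emeasure_pmf_single)
qed

lemma AE_binary_arm: "AE x in binary_arm p. x \<in> {0, 1}"
proof -
  have "{x \<in> space unit_borel. x \<in> {0, 1}} \<in> sets unit_borel"
    by (auto simp: sets_restrict_space_iff space_restrict_space intro!: borel_closed finite_imp_closed)
  then show ?thesis
    unfolding binary_arm_def by (simp add: AE_distr_iff[OF measurable_of_bool_unit_borel])
qed

section \<open>Expected best cost on two-valued arms\<close>

lemma measurable_sample_space_component:
  assumes "k \<in> {1..K}" "1 \<le> s" "sets (\<mu> k) = sets unit_borel"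
  shows "(\<lambda>x. x (k, s)) \<in> measurable (sample_space K \<mu>) unit_borel"
proof -
  have "(\<lambda>x. x (k, s)) \<in> measurable (sample_space K \<mu>) (\<mu> k)"
    using measurable_component_singleton[of "(k, s)" "{1..K} \<times> {1..}" "\<lambda>(k, t). \<mu> k"] assms
    by (simp add: sample_space_def)
  then show ?thesis
    by (simp add: measurable_cong_sets[OF refl assms(3)])
qed

text \<open>
  Both the policy and the constant strategies of the oracle have the form \<open>\<kappa>\<close> required here.
\<close>

lemma expected_best_cost_binary:
  fixes p :: "nat \<Rightarrow> real" and a :: "nat \<Rightarrow> nat"
  assumes p: "\<And>k. 0 \<le> p k" "\<And>k. p k \<le> 1"
    and a: "\<And>t. a t \<in> {1..K}"
    and \<kappa>: "\<And>t. (\<lambda>x. \<kappa> x t)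
        \<in> measurable (sample_space K (\<lambda>k. binary_arm (p k))) (count_space {1..K})"
    and follows: "\<And>x t. (\<And>s. s \<in> {1..<t} \<Longrightarrow> x (a s, s) = 1) \<Longrightarrow> \<kappa> x t = a t"
    and "1 \<le> T"
  shows "expected_best_cost K (\<lambda>k. binary_arm (p k)) \<kappa> T = (\<Prod>t\<in>{1..T}. p (a t))"
proof -
  define S where "S = sample_space K (\<lambda>k. binary_arm (p k))"
  define I where "I = {1..K} \<times> {1::nat..}"
  define M where "M = (\<lambda>(k, t::nat). binary_arm (p k))"
  define J where "J = (\<lambda>t. (a t, t)) ` {1..T}"
  \<comment> \<open>The cylinder on which the first \<open>T\<close> values along \<open>a\<close>
    are all 1. Distinct times give distinct coordinates, so independence yields the product of the
    \<open>p (a t)\<close>.\<close>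
  define E where "E = prod_emb I M J (\<Pi>\<^sub>E j\<in>J. {1})"
  have S: "S = Pi\<^sub>M I M"
    by (simp add: S_def sample_space_def I_def M_def)
  have prob: "prob_space (M i)" for i
    by (simp add: M_def prob_space_binary_arm split: prod.split)
  have J: "finite J" "J \<subseteq> I"
    using a by (auto simp: J_def I_def)
  have one: "{1} \<in> sets (M i)" for i
    by (simp add: M_def singleton_1_in_sets_unit_borel split: prod.split)
  have E: "E = {x \<in> space S. \<forall>t\<in>{1..T}. x (a t, t) = 1}"
    unfolding E_def S set_eq_iff prod_emb_iff restrict_PiE_iff space_PiM
    by (auto simp: J_def PiE_iff)
  have E_sets: "E \<in> sets S"
    unfolding S E_def using J one by (intro sets_PiM_I) auto
  have "emeasure S E = (\<Prod>i\<in>J. emeasure (M i) {1})"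
    unfolding S E_def by (intro emeasure_PiM_emb prob J one)
  also have "\<dots> = (\<Prod>t\<in>{1..T}. ennreal (p (a t)))"
    unfolding J_def
    by (subst prod.reindex) (auto simp: inj_on_def M_def emeasure_binary_arm_1 p)
  also have "\<dots> = ennreal (\<Prod>t\<in>{1..T}. p (a t))"
    using p by (intro prod_ennreal) auto
  finally have measure_E: "measure S E = (\<Prod>t\<in>{1..T}. p (a t))"
    using p by (simp add: measure_def prod_nonneg)

  have component: "(\<lambda>x. x (k, s)) \<in> borel_measurable S" if "k \<in> {1..K}" "1 \<le> s" for k s
    using measurable_sample_space_component[OF that, of "\<lambda>k. binary_arm (p k)"]
    unfolding S_def measurable_restrict_space2_iff by simp
  have cost_measurable: "(\<lambda>x. MIN t\<in>{1..T}. x (\<kappa> x t, t)) \<in> borel_measurable S"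
  proof (rule borel_measurable_Min)
    fix t assume "t \<in> {1..T}"
    then show "(\<lambda>x. x (\<kappa> x t, t)) \<in> borel_measurable S"
      by - (rule measurable_compose_countable'[where f = "\<lambda>k x. x (k, t)",
            OF component \<kappa>[folded S_def]], simp_all)
  qed simp
  \<comment> \<open>All coordinates are treated at once, by countability of \<open>I\<close>, since
    the coordinate read at time \<open>t\<close> varies with the outcome.\<close>
  have AE_01: "AE x in S. \<forall>i\<in>I. x i \<in> {0, 1}"
    unfolding S
  proof (intro AE_ball_countable' AE_PiM_component prob)
    show "AE x in M i. x \<in> {0, 1}" for i
      by (cases i) (simp only: M_def prod.case AE_binary_arm)
  qed (auto simp: I_def)
  have "AE x in S. (MIN t\<in>{1..T}. x (\<kappa> x t, t)) = indicator E x"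
    using AE_01 AE_space
  proof eventually_elim
    case (elim x)
    have range: "x (\<kappa> x t, t) \<in> {0, 1}" if "t \<in> {1..T}" for t
      using elim measurable_space[OF \<kappa>, of x t] that unfolding S_def[symmetric] by (auto simp: I_def)
    show ?case
    proof (cases "x \<in> E")
      case True
      then have "x (\<kappa> x t, t) = 1" if "t \<in> {1..T}" for t
        using that follows[of t x] by (auto simp: E)
      then have "(\<lambda>t. x (\<kappa> x t, t)) ` {1..T} = {1}"
        using \<open>1 \<le> T\<close> by force
      then show ?thesis
        using True by simp
    next
      case False
      \<comment> \<open>If only 1 were observed, \<kappa> would follow \<open>a\<close> step by
        step, and the outcome would lie in \<open>E\<close>.\<close>
      have "\<exists>t\<in>{1..T}. x (\<kappa> x t, t) \<noteq> 1"
      proof (rule ccontr)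
        assume "\<not> ?thesis"
        then have one: "x (\<kappa> x t, t) = 1" if "t \<in> {1..T}" for t
          using that by blast
        have "t \<in> {1..T} \<Longrightarrow> x (a t, t) = 1" for t
        proof (induction t rule: less_induct)
          case (less t)
          then have "\<kappa> x t = a t"
            by (intro follows) auto
          then show ?case
            using one[OF less.prems] by simp
        qed
        then show False
          using False elim by (simp add: E)
      qed
      then obtain t where "t \<in> {1..T}" "x (\<kappa> x t, t) = 0"
        using range by blast
      then have "(MIN t\<in>{1..T}. x (\<kappa> x t, t)) = 0"
        using range by (intro Min_eqI) force+
      then show ?thesis
        using False by simp
    qed
  qed
  then have "(\<integral>x. (MIN t\<in>{1..T}. x (\<kappa> x t, t)) \<partial>S) = (\<integral>x. indicator E x \<partial>S)"
    using cost_measurable E_sets by (intro integral_cong_AE) auto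
  also have "\<dots> = measure S E"
    using E_sets sets.sets_into_space[OF E_sets] by (simp add: Int_absorb2)
  finally show ?thesis
    unfolding expected_best_cost_def S_def[symmetric] measure_E .
qed

section \<open>Counting the plays of an arm\<close>

text \<open>The play counts sum to \<open>T\<close>, so for each \<open>T\<close> some arm has at
  most the average. As there are finitely many arms, one of them qualifies infinitely often.\<close>

lemma exists_rarely_played:
  fixes a :: "nat \<Rightarrow> nat"
  assumes "\<And>t. a t \<in> {1..K}"
  shows "\<exists>k\<in>{1..K}. \<exists>\<^sub>F T in sequentially. K * card {t\<in>{1..T}. a t = k} \<le> T"
proof (rule frequently_bex_finite)
  have "\<exists>k\<in>{1..K}. K * card {t\<in>{1..T}. a t = k} \<le> T" for T
  proof (rule ccontr)
    assume "\<not> ?thesis"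
    \<comment> \<open>Strictness of the sum needs a nonempty index set, which the element
      \<open>a 0\<close> witnesses.\<close>
    then have "(\<Sum>k\<in>{1..K}. T) < (\<Sum>k\<in>{1..K}. K * card {t\<in>{1..T}. a t = k})"
      using assms[of 0] by (intro sum_strict_mono) (simp_all, force simp: not_le)
    also have "\<dots> = K * (\<Sum>k\<in>{1..K}. \<Sum>t\<in>{t\<in>{1..T}. a t = k}. 1)"
      by (simp add: sum_distrib_left)
    also have "(\<Sum>k\<in>{1..K}. \<Sum>t\<in>{t\<in>{1..T}. a t = k}. 1) = T"
      using assms by (subst sum.group) auto
    finally show False
      by simp
  qed
  then show "\<exists>\<^sub>F T in sequentially. \<exists>k\<in>{1..K}. K * card {t\<in>{1..T}. a t = k} \<le> T"
    by simp
qed simp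

text \<open>Here \<open>N\<close> counts plays. If \<open>K * N S \<le> S\<close>, then reaching
  \<open>N S + 1\<close> plays takes more than \<open>S\<close> rounds, so
  \<open>T = N S + 1\<close> qualifies. If these values stay below a bound \<open>B\<close>,
  monotonicity keeps \<open>N\<close> below \<open>B\<close> everywhere, and \<open>T = B\<close>
  qualifies vacuously.\<close>

lemma frequently_late:
  fixes N :: "nat \<Rightarrow> nat"
  assumes "mono N" and freq: "\<exists>\<^sub>F T in sequentially. K * N T \<le> T"
  shows "\<exists>\<^sub>F T in sequentially. \<forall>T'. T \<le> N T' \<longrightarrow> K * (T - 1) \<le> T'"
  unfolding frequently_sequentially
proof
  fix B
  show "\<exists>T\<ge>B. \<forall>T'. T \<le> N T' \<longrightarrow> K * (T - 1) \<le> T'"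
  proof (cases "\<exists>T. K * N T \<le> T \<and> B \<le> N T + 1")
    case True
    then obtain T where T: "K * N T \<le> T" "B \<le> N T + 1"
      by blast
    have "K * N T \<le> T'" if "N T + 1 \<le> N T'" for T'
    proof -
      have "T < T'"
        using that monoD[OF \<open>mono N\<close>, of T' T] by (cases "T' \<le> T") auto
      then show ?thesis
        using T by simp
    qed
    then show ?thesis
      using T by (intro exI[of _ "N T + 1"]) auto
  next
    case False
    have "N T' < B" for T'
    proof -
      obtain T where "T' \<le> T" "K * N T \<le> T"
        using freq unfolding frequently_sequentially by blast
      then show ?thesis
        using False monoD[OF \<open>mono N\<close>, of T' T] by force
    qed
    then show ?thesis
      by (intro exI[of _ B]) (auto simp: not_le[symmetric])
  qed
qed

section \<open>The hard instance and its regret\<close>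

theorem theorem11:
  fixes K :: nat and \<pi> :: "nat list \<Rightarrow> real list \<Rightarrow> nat"
  assumes "1 \<le> K" and "policy K \<pi>"
  shows "\<exists>\<mu> :: nat \<Rightarrow> real measure.
           (\<forall>k\<in>{1..K}. arm_distribution (\<mu> k)) \<and>
           limsup (\<lambda>T. extreme_regret K \<mu> \<pi> T) \<ge> ereal (real K)"
proof -
  define a where "a = chosen_arm \<pi> (\<lambda>_. 1)"
  have a: "a t \<in> {1..K}" for t
    using measurable_space[OF measurable_chosen_arm[OF \<open>policy K \<pi>\<close>,
          of "\<lambda>_ _. 1" "count_space UNIV" t]]
    by (auto simp: a_def space_restrict_space)
  obtain k\<^sub>0 where k\<^sub>0: "k\<^sub>0 \<in> {1..K}"
    and rare: "\<exists>\<^sub>F T in sequentially. K * card {t\<in>{1..T}. a t = k\<^sub>0} \<le> T"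
    using exists_rarely_played[of a K] a by blast
  define N where "N T = card {t\<in>{1..T}. a t = k\<^sub>0}" for T
  have "mono N"
    unfolding N_def by (intro monoI card_mono) auto
  \<comment> \<open>Only plays of \<open>k\<^sub>0\<close> contribute a factor below 1, so the
    policy's cost is a strictly decreasing function of the number of these plays.\<close>
  define p :: "nat \<Rightarrow> real" where "p k = (if k = k\<^sub>0 then 1/2 else 1)" for k
  have p: "0 \<le> p k" "p k \<le> 1" for k
    by (auto simp: p_def)
  define \<mu> where "\<mu> k = binary_arm (p k)" for k

  have "expected_best_cost K \<mu> (chosen_arm \<pi>) T = (\<Prod>t\<in>{1..T}. p (a t))" if "1 \<le> T" for T
    unfolding \<mu>_def
  proof (intro expected_best_cost_binary p a that)
    show "(\<lambda>x. chosen_arm \<pi> x t)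
        \<in> measurable (sample_space K (\<lambda>k. binary_arm (p k))) (count_space {1..K})" for t
      by (intro measurable_chosen_arm[OF \<open>policy K \<pi>\<close>] measurable_sample_space_component) auto
    show "chosen_arm \<pi> x t = a t" if "\<And>s. s \<in> {1..<t} \<Longrightarrow> x (a s, s) = 1" for x t
      using that unfolding a_def by (intro chosen_arm_cong) auto
  qed
  moreover have "N T = card ({1..T} \<inter> {t. a t = k\<^sub>0})" for T
    unfolding N_def by (rule arg_cong[where f = card]) auto
  ultimately have policy_cost: "expected_best_cost K \<mu> (chosen_arm \<pi>) T = (1/2) ^ N T" if "1 \<le> T" for T
    using that by (simp add: p_def prod.If_cases)

  have "expected_best_cost K \<mu> (\<lambda>_ _. k\<^sub>0) T = (\<Prod>t\<in>{1..T}. p k\<^sub>0)" if "1 \<le> T" for T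
    unfolding \<mu>_def using k\<^sub>0 that by (intro expected_best_cost_binary p) auto
  \<comment> \<open>An upper bound suffices: matching the oracle then forces a cost of at most
    \<open>(1/2) ^ T\<close>.\<close>
  then have oracle_cost: "expected_best_cost K \<mu> (\<lambda>_ _. oracle_arm K \<mu> T) T \<le> (1/2) ^ T"
    if "1 \<le> T" for T
    using arg_min_least[of "{1..K}" k\<^sub>0 "\<lambda>k. expected_best_cost K \<mu> (\<lambda>_ _. k) T"] k\<^sub>0 that
    by (auto simp: oracle_arm_def p_def)

  \<comment> \<open>The loss \<open>K / T\<close> comes from \<open>T - 1\<close> in place of
    \<open>T\<close> and vanishes in the limit. If no \<open>T'\<close> is admissible, the infimum
    is \<infinity> and the bound still holds.\<close>
  have regret: "ereal (real K - real K / real T) \<le> extreme_regret K \<mu> \<pi> T"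
    if late: "\<forall>T'. T \<le> N T' \<longrightarrow> K * (T - 1) \<le> T'" and "1 \<le> T" for T
  proof -
    have "ereal (real (K * (T - 1))) \<le> ereal (real T')"
      if T': "1 \<le> T'" "expected_best_cost K \<mu> (chosen_arm \<pi>) T'
        \<le> expected_best_cost K \<mu> (\<lambda>_ _. oracle_arm K \<mu> T) T" for T'
    proof -
      have "(1/2 :: real) ^ N T' \<le> (1/2) ^ T"
        using order_trans[OF T'(2) oracle_cost[OF \<open>1 \<le> T\<close>]] policy_cost[OF T'(1)] by simp
      then have "T \<le> N T'"
        by simp
      then show ?thesis
        using late by (metis ereal_less_eq(3) of_nat_le_iff)
    qed
    then have "ereal (real (K * (T - 1))) / ereal (real T) \<le> extreme_regret K \<mu> \<pi> T"
      unfolding extreme_regret_def using \<open>1 \<le> T\<close>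
      by (intro ereal_divide_right_mono INF_greatest) auto
    moreover have "real (K * (T - 1)) / real T = real K - real K / real T"
      using \<open>1 \<le> T\<close> by (simp add: field_simps of_nat_diff)
    ultimately show ?thesis
      using \<open>1 \<le> T\<close> by simp
  qed

  have "ereal (real K) \<le> limsup (extreme_regret K \<mu> \<pi>)"
  proof (rule ccontr)
    assume "\<not> ?thesis"
    \<comment> \<open>A value \<open>y\<close> strictly between the two sides is eventually above
      the regret, yet infinitely often below it.\<close>
    then obtain y where limsup: "limsup (extreme_regret K \<mu> \<pi>) < y" and y: "y < ereal (real K)"
      using dense by (auto simp: not_le)
    have "((\<lambda>T. ereal (real K - real K / real T)) \<longlongrightarrow> ereal (real K - 0)) sequentially"
      by (intro tendsto_ereal tendsto_intros lim_const_over_n)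
    then have "\<forall>\<^sub>F T in sequentially. y < ereal (real K - real K / real T)"
      using y by (intro order_tendstoD) auto
    then have "\<forall>\<^sub>F T in sequentially. 1 \<le> T \<and> y < ereal (real K - real K / real T)"
      using eventually_ge_at_top by (intro eventually_conj)
    from frequently_eventually_frequently[OF
        frequently_late[OF \<open>mono N\<close> rare[folded N_def]] this]
    have "\<exists>\<^sub>F T in sequentially. y < extreme_regret K \<mu> \<pi> T"
      by (rule frequently_elim1) (use regret less_le_trans in blast)
    from frequently_eventually_frequently[OF this Limsup_lessD[OF limsup]]
    show False
      by (auto dest!: frequently_ex)
  qed
  then show ?thesis
    by (intro exI[of _ \<mu>]) (auto simp: \<mu>_def arm_distribution_binary_arm)
qed

end
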